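(* Let $n\geq 2$ be a positive integer. Let $G$ be a graph containing $M(M(K_n))$ as a subgraph. For every graph $H$, if $\chi(G\times H)=n+1$, then $\min\{\chi(G),\chi(H)\}=n+1$.
   Context: All graphs are finite, undirected, without multiple edges. $E(G)\subseteq V(G)\times V(G)$ is the symmetric edge relation, and $x \sim y$ means $(x,y)\in E(G)$. A subgraph $H$ of $G$ is a graph with $V(H)\subseteq V(G)$, $E(H)\subseteq E(G)$. $K_n$ is the complete graph on $\{1,\dots,n\}$ (no loops). The chromatic number is defined for simple (loopless) graphs, so $G$ and $H$ are simple: $\chi(G)$ is the least $n$ such that there is a graph homomorphism (edge-preserving vertex map) $G\to K_n$. Categorical product: $G\times H$ has vertex set $V(G)\times V(H)$, with $(g,h)\sim(g',h')$ iff $g\sim g'$ in $G$ and $h\sim h'$ in $H$. Mycielskian: let $L_2(\{0\})$ be the graph with vertex set $\{0,1,2\}$, edges $0\sim1$, $1\sim2$ and a loop at $0$. For a graph $G$, the Mycielskian $M(G)$ is the quotient of $G\times L_2(\{0\})$ identifying all vertices with second coordinate $2$ to a single vertex (two vertices of the quotient are adjacent iff some representatives are adjacent). *)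

theory Defs
  imports "Graph_Theory.Graph_Theory"
begin

text \<open>
  Graphs are records \<^typ>\<open>'a pair_pre_digraph\<close>: a vertex set together with an edge relation. The
  locale \<^locale>\<open>pair_graph\<close> singles out the finite simple graphs (symmetric and loopless edge
  relation); the constructions below also make sense for graphs with loops such as \<open>L2\<close>.
\<close>

definition graph_hom ::
    "'a pair_pre_digraph \<Rightarrow> 'b pair_pre_digraph \<Rightarrow> ('a \<Rightarrow> 'b) \<Rightarrow> bool" where
  "graph_hom G H f \<longleftrightarrow>
     (\<forall>v \<in> pverts G. f v \<in> pverts H) \<and>
     (\<forall>u v. (u, v) \<in> parcs G \<longrightarrow> (f u, f v) \<in> parcs H)"

definition complete_graph :: "nat \<Rightarrow> nat pair_pre_digraph" where
  "complete_graph n =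
     \<lparr> pverts = {1..n}, parcs = {(u, v). u \<in> {1..n} \<and> v \<in> {1..n} \<and> u \<noteq> v} \<rparr>"

text \<open>
  Meaningful only if some \<open>n\<close> is attained, as is the case for every finite loopless graph.
\<close>

definition chromatic_number :: "'a pair_pre_digraph \<Rightarrow> nat" where
  "chromatic_number G = (LEAST n. \<exists>f. graph_hom G (complete_graph n) f)"

definition cat_product ::
    "'a pair_pre_digraph \<Rightarrow> 'b pair_pre_digraph \<Rightarrow> ('a \<times> 'b) pair_pre_digraph" where
  "cat_product G H =
     \<lparr> pverts = pverts G \<times> pverts H,
       parcs = {((g, h), (g', h')) | g h g' h'. (g, g') \<in> parcs G \<and> (h, h') \<in> parcs H} \<rparr>"

text \<open>
  The vertices of a quotient graph are the equivalence classes themselves.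
\<close>

definition quotient_graph :: "'a pair_pre_digraph \<Rightarrow> 'a rel \<Rightarrow> 'a set pair_pre_digraph" where
  "quotient_graph G r =
     \<lparr> pverts = pverts G // r,
       parcs = {(X, Y). X \<in> pverts G // r \<and> Y \<in> pverts G // r \<and>
                        (\<exists>x \<in> X. \<exists>y \<in> Y. (x, y) \<in> parcs G)} \<rparr>"

definition L2 :: "nat pair_pre_digraph" where
  "L2 = \<lparr> pverts = {0, 1, 2}, parcs = {(0, 0), (0, 1), (1, 0), (1, 2), (2, 1)} \<rparr>"

definition apex_rel :: "'a set \<Rightarrow> ('a \<times> nat) rel" where
  "apex_rel V =
     {(p, q). p \<in> V \<times> {0, 1, 2} \<and> q \<in> V \<times> {0, 1, 2} \<and> (p = q \<or> snd p = 2 \<and> snd q = 2)}"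

definition mycielskian :: "'a pair_pre_digraph \<Rightarrow> ('a \<times> nat) set pair_pre_digraph" where
  "mycielskian G = quotient_graph (cat_product G L2) (apex_rel (pverts G))"

text \<open>
  The graph \<open>F\<close> lives on a vertex type of its own, so containing \<open>F\<close> as a subgraph means having a
  subgraph isomorphic to \<open>F\<close>.
\<close>

definition contains_as_subgraph ::
    "'a pair_pre_digraph \<Rightarrow> 'b pair_pre_digraph \<Rightarrow> bool" where
  "contains_as_subgraph G F \<longleftrightarrow>
     (\<exists>S :: 'a pair_pre_digraph. subgraph (with_proj S) (with_proj G) \<and>
        digraph_iso (with_proj F) (with_proj S))"

end

theory Submission
  imports Defs "HOL-Combinatorics.Permutations"
begin

text \<open>
  Since the projections give \<open>\<chi>(G \<times> H) \<le> \<chi>(G)\<close> and \<open>\<chi>(G \<times> H) \<le> \<chi>(H)\<close>, it suffices to show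
  \<open>\<chi>(H) \<le> n + 1\<close>. A colouring \<open>c\<close> of \<open>G \<times> H\<close> with \<open>n + 1\<close> colours turns each vertex \<open>h\<close> of \<open>H\<close> into a
  function \<open>c(-, h)\<close> on \<open>G\<close>, not necessarily a proper colouring; if \<open>h \<sim> h'\<close> in \<open>H\<close> and \<open>u \<sim> v\<close> in \<open>G\<close>,
  then \<open>c(u, h) \<noteq> c(v, h')\<close>. Only the values on the copy of \<open>M(M(K\<^sub>n))\<close> matter. Write \<open>x\<^sub>i\<close>
  for its clique, \<open>y\<^sub>i\<close> and \<open>z\<close> for the copies and the apex added by the first Mycielskian, and
  \<open>x'\<^sub>i\<close>, \<open>y'\<^sub>i\<close>, \<open>z'\<close>, \<open>w\<close> for the copies and the apex added by the second.

  Let the palette of \<open>h\<close> be the set of colours \<open>c(x\<^sub>i, h)\<close>. If some colour in the palette of \<open>h\<close> is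
  absent from the palettes of all neighbours of \<open>h\<close>, give \<open>h\<close> such a colour. As every vertex will
  get a colour from its own palette, this can never clash with a neighbour. For instance, a colour
  that occurs twice among the \<open>c(x\<^sub>i, h)\<close> will do. The remaining, locked, vertices therefore have
  a palette of \<open>n\<close> distinct colours, which misses exactly one colour \<open>m(h)\<close>, and for these
  \<open>c(y\<^sub>i, h)\<close> is \<open>c(x\<^sub>i, h)\<close> or \<open>m(h)\<close> (lemma \<open>locked_copy\<close>).

  The locked vertices induce a bipartite graph. Given a bipartition, colour one side by
  \<open>c(x\<^sub>1, h)\<close> and the other by \<open>c(x\<^sub>2, h)\<close>: this is proper because \<open>x\<^sub>1 \<sim> x\<^sub>2\<close>. To find the
  bipartition, list the colours as \<open>c(x\<^sub>1, h), \<dots>, c(x\<^sub>n, h), m(h)\<close>; adjacent locked vertices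
  have the same list, or lists that differ by exchanging one entry with the last one. Let
  \<open>P(h)\<close> mean that \<open>c(z, h) = m(h)\<close>, and \<open>Q(h)\<close> that \<open>c(y\<^sub>i, h) = m(h)\<close> for some \<open>i\<close>.
  Across an exchange, the sign of the list changes while \<open>P(h) \<longleftrightarrow> Q(h')\<close> and
  \<open>P(h') \<longleftrightarrow> Q(h)\<close> (lemma \<open>locked_swapped_palette\<close>). Across an edge with equal lists,
  \<open>P\<close> and \<open>Q\<close> agree at each end and differ between the ends (lemmas \<open>equal_palette_apex\<close> and
  \<open>locked_equal_palette\<close>); this is where the second Mycielskian enters. The first one alone cannot suffice
  here, because a proper colouring of \<open>M(K\<^sub>n)\<close> with \<open>n + 1\<close> colours, taken as \<open>c(-, h)\<close> for every \<open>h\<close>,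
  colours \<open>M(K\<^sub>n) \<times> H\<close> for any \<open>H\<close>. So \<open>P\<close>, corrected by the sign when \<open>P(h) = Q(h)\<close>, changes along every
  edge (lemma \<open>locked_sides\<close>).
\<close>

section \<open>Graphs whose product with a doubly iterated Mycielskian is coloured\<close>

text \<open>
  The relation \<open>A\<close> belongs to the first factor and \<open>B\<close> to the second. The named vertices need not
  be distinct: a homomorphic image of the doubly iterated Mycielskian suffices.
\<close>

locale double_mycielskian_coloring =
  fixes n :: nat
    and A :: "'a rel" and B :: "'b rel" and V :: "'b set"
    and x y x' y' :: "nat \<Rightarrow> 'a" and z z' w :: 'a
    and c :: "'a \<Rightarrow> 'b \<Rightarrow> nat"
  assumes n_ge_2: "n \<ge> 2"
    and sym_A: "sym A" and sym_B: "sym B" and B_sub: "B \<subseteq> V \<times> V"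
    and xx: "\<And>i j. i \<in> {1..n} \<Longrightarrow> j \<in> {1..n} \<Longrightarrow> i \<noteq> j \<Longrightarrow> (x i, x j) \<in> A"
    and xy: "\<And>i j. i \<in> {1..n} \<Longrightarrow> j \<in> {1..n} \<Longrightarrow> i \<noteq> j \<Longrightarrow> (x i, y j) \<in> A"
    and yz: "\<And>i. i \<in> {1..n} \<Longrightarrow> (y i, z) \<in> A"
    and xx': "\<And>i j. i \<in> {1..n} \<Longrightarrow> j \<in> {1..n} \<Longrightarrow> i \<noteq> j \<Longrightarrow> (x i, x' j) \<in> A"
    and xy': "\<And>i j. i \<in> {1..n} \<Longrightarrow> j \<in> {1..n} \<Longrightarrow> i \<noteq> j \<Longrightarrow> (x i, y' j) \<in> A"
    and yx': "\<And>i j. i \<in> {1..n} \<Longrightarrow> j \<in> {1..n} \<Longrightarrow> i \<noteq> j \<Longrightarrow> (y i, x' j) \<in> A"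
    and yz': "\<And>i. i \<in> {1..n} \<Longrightarrow> (y i, z') \<in> A"
    and zy': "\<And>i. i \<in> {1..n} \<Longrightarrow> (z, y' i) \<in> A"
    and x'w: "\<And>i. i \<in> {1..n} \<Longrightarrow> (x' i, w) \<in> A"
    and y'w: "\<And>i. i \<in> {1..n} \<Longrightarrow> (y' i, w) \<in> A"
    and z'w: "(z', w) \<in> A"
    and c_range: "\<And>u v h. (u, v) \<in> A \<Longrightarrow> h \<in> V \<Longrightarrow> c u h \<in> {1..n + 1}"
    and c_proper: "\<And>u v h h'. (u, v) \<in> A \<Longrightarrow> (h, h') \<in> B \<Longrightarrow> c u h \<noteq> c v h'"
begin

definition palette :: "'b \<Rightarrow> nat set" where
  "palette h = (\<lambda>i. c (x i) h) ` {1..n}"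

definition rainbow :: "'b \<Rightarrow> bool" where
  "rainbow h \<longleftrightarrow> inj_on (\<lambda>i. c (x i) h) {1..n}"

definition missing :: "'b \<Rightarrow> nat" where
  "missing h = (SOME k. k \<in> {1..n + 1} - palette h)"

definition free :: "'b \<Rightarrow> nat \<Rightarrow> bool" where
  "free h k \<longleftrightarrow> k \<in> palette h \<and> (\<forall>h'. (h, h') \<in> B \<longrightarrow> k \<notin> palette h')"

definition locked :: "'b \<Rightarrow> bool" where
  "locked h \<longleftrightarrow> h \<in> V \<and> (\<nexists>k. free h k)"

lemma B_sym: "(h, h') \<in> B \<Longrightarrow> (h', h) \<in> B"
  using sym_B by (rule symD)

lemma A_sym: "(u, v) \<in> A \<Longrightarrow> (v, u) \<in> A"
  using sym_A by (rule symD)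

lemma B_V: "(h, h') \<in> B \<Longrightarrow> h \<in> V" "(h, h') \<in> B \<Longrightarrow> h' \<in> V"
  using B_sub by auto

lemma other_index:
  obtains j where "j \<in> {1..n}" "j \<noteq> i"
proof (cases "i = 1")
  case True
  then show ?thesis using n_ge_2 that[of 2] by auto
next
  case False
  then show ?thesis using n_ge_2 that[of 1] by auto
qed

lemma named_range:
  assumes "h \<in> V"
  shows "i \<in> {1..n} \<Longrightarrow> c (x i) h \<in> {1..n + 1}"
    and "i \<in> {1..n} \<Longrightarrow> c (y i) h \<in> {1..n + 1}"
    and "c z h \<in> {1..n + 1}" "c z' h \<in> {1..n + 1}" "c w h \<in> {1..n + 1}"
proof -
  show "i \<in> {1..n} \<Longrightarrow> c (x i) h \<in> {1..n + 1}"
    using other_index[of i] xx c_range assms by metis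
  show "i \<in> {1..n} \<Longrightarrow> c (y i) h \<in> {1..n + 1}"
    using yz c_range assms by metis
  have "1 \<in> {1..n}" using n_ge_2 by simp
  then show "c z h \<in> {1..n + 1}" using zy' c_range assms by metis
  show "c z' h \<in> {1..n + 1}" using z'w c_range assms by metis
  show "c w h \<in> {1..n + 1}" using A_sym[OF z'w] c_range assms by metis
qed

subsection \<open>Rainbow vertices and their missing colour\<close>

lemma palette_missing:
  assumes "h \<in> V" "rainbow h"
  shows "missing h \<notin> palette h" "insert (missing h) (palette h) = {1..n + 1}"
proof -
  have sub: "palette h \<subseteq> {1..n + 1}"
    using named_range(1)[OF assms(1)] unfolding palette_def by blast
  have card: "card (palette h) = n"
    using assms(2) unfolding palette_def rainbow_def by (simp add: card_image)
  have "palette h \<noteq> {1..n + 1}" using card by auto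
  then have "\<exists>k. k \<in> {1..n + 1} - palette h" using sub by blast
  then have m: "missing h \<in> {1..n + 1} - palette h"
    unfolding missing_def by (rule someI_ex)
  then show "missing h \<notin> palette h" by blast
  show "insert (missing h) (palette h) = {1..n + 1}"
  proof (rule card_subset_eq)
    show "card (insert (missing h) (palette h)) = card {1..n + 1}"
      using m card by (simp add: palette_def)
  qed (use m sub in auto)
qed

lemma missing_neq: "h \<in> V \<Longrightarrow> rainbow h \<Longrightarrow> i \<in> {1..n} \<Longrightarrow> c (x i) h \<noteq> missing h"
  using palette_missing(1) unfolding palette_def by force

lemma missing_range: "h \<in> V \<Longrightarrow> rainbow h \<Longrightarrow> missing h \<in> {1..n + 1}"
  using palette_missing(2) by blast

lemma color_cases:
  assumes "h \<in> V" "rainbow h" "k \<in> {1..n + 1}"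
  obtains "k = missing h" | i where "i \<in> {1..n}" "k = c (x i) h"
  using palette_missing(2)[OF assms(1,2)] assms(3) unfolding palette_def by blast

lemma missing_eqI:
  assumes "h \<in> V" "rainbow h" "k \<in> {1..n + 1}" "\<And>i. i \<in> {1..n} \<Longrightarrow> c (x i) h \<noteq> k"
  shows "missing h = k"
  using color_cases[OF assms(1-3)] assms(4) by metis

text \<open>
  A vertex adjacent to all \<open>x j\<close> except possibly \<open>x i\<close> must avoid, at a neighbour of a rainbow vertex,
  \<open>n - 1\<close> of the \<open>n + 1\<close> colours. This applies to \<open>x i\<close>, \<open>y i\<close>, \<open>x' i\<close> and \<open>y' i\<close> alike.
\<close>

lemma neighbour_color:
  assumes h: "rainbow h" and e: "(h, h') \<in> B" and i: "i \<in> {1..n}"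
    and v: "\<And>j. j \<in> {1..n} \<Longrightarrow> j \<noteq> i \<Longrightarrow> (x j, v) \<in> A"
  shows "c v h' = c (x i) h \<or> c v h' = missing h"
proof -
  obtain j where j: "j \<in> {1..n}" "j \<noteq> i" using other_index by blast
  have "c v h' \<in> {1..n + 1}" using c_range[OF A_sym[OF v[OF j]]] B_V[OF e] by blast
  with B_V(1)[OF e] h show ?thesis
  proof (cases rule: color_cases)
    case (2 k)
    then have "k = i" using c_proper[OF v e] by metis
    then show ?thesis using 2 by simp
  qed simp
qed

subsection \<open>Locked vertices\<close>

text \<open>
  A colour repeated at \<open>x i\<close> and \<open>x j\<close> is free: each \<open>x l\<close> is adjacent to at least one of these two, so
  no neighbour can use it on the clique.
\<close>

lemma locked_rainbow:
  assumes "locked h"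
  shows "rainbow h"
  unfolding rainbow_def
proof (rule inj_onI, rule ccontr)
  fix i j
  assume ij: "i \<in> {1..n}" "j \<in> {1..n}" "c (x i) h = c (x j) h" "i \<noteq> j"
  have "c (x i) h \<noteq> c (x l) h'" if e: "(h, h') \<in> B" and l: "l \<in> {1..n}" for l h'
    using c_proper[OF xx e] ij l by metis
  then have "free h (c (x i) h)"
    using ij unfolding free_def palette_def by blast
  then show False using assms unfolding locked_def by blast
qed

text \<open>
  The colour at \<open>x i\<close> is not free, and the only clique vertex at which a neighbour can repeat it
  is \<open>x i\<close> itself.
\<close>

lemma locked_fixed:
  assumes "locked h" "i \<in> {1..n}"
  obtains h' where "(h, h') \<in> B" "c (x i) h' = c (x i) h"
proof -
  have "\<not> free h (c (x i) h)" using assms(1) unfolding locked_def by blast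
  then obtain h' l where "(h, h') \<in> B" "l \<in> {1..n}" "c (x i) h = c (x l) h'"
    using assms(2) unfolding free_def palette_def by blast
  then show ?thesis using that c_proper[OF xx] assms(2) by metis
qed

text \<open>
  If \<open>y i\<close> had the colour of \<open>x j\<close> with \<open>j \<noteq> i\<close>, no neighbour could have that colour at \<open>x j\<close>, which is
  adjacent to \<open>y i\<close>; the colour would be free.
\<close>

lemma locked_copy:
  assumes h: "locked h" and i: "i \<in> {1..n}"
  shows "c (y i) h = c (x i) h \<or> c (y i) h = missing h"
proof -
  have V: "h \<in> V" using h unfolding locked_def by blast
  show ?thesis
  proof (cases rule: color_cases[OF V locked_rainbow[OF h] named_range(2)[OF V i]])
    case (2 j)
    obtain h' where h': "(h, h') \<in> B" "c (x j) h' = c (x j) h"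
      using locked_fixed[OF h 2(1)] .
    then have "j = i"
      using 2 i c_proper[OF xy B_sym[OF h'(1)]] by metis
    then show ?thesis using 2 by simp
  qed simp
qed

definition apex_missing :: "'b \<Rightarrow> bool" where
  "apex_missing h \<longleftrightarrow> c z h = missing h"

definition copy_missing :: "'b \<Rightarrow> bool" where
  "copy_missing h \<longleftrightarrow> (\<exists>i\<in>{1..n}. c (y i) h = missing h)"

text \<open>
  Storing the missing colour at position \<open>n + 1\<close> makes the colours on the clique a permutation of
  \<open>{1..n + 1}\<close>, so that their order has a sign.
\<close>

definition arrangement :: "'b \<Rightarrow> nat \<Rightarrow> nat" where
  "arrangement h i = (if i \<in> {1..n} then c (x i) h else if i = n + 1 then missing h else i)"

definition side :: "'b \<Rightarrow> bool" where
  "side h \<longleftrightarrow> (if apex_missing h = copy_missing h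
    then apex_missing h = evenperm (arrangement h) else apex_missing h)"

subsection \<open>The locked vertices induce a bipartite graph\<close>

lemma arrangement_permutes:
  assumes "h \<in> V" "rainbow h"
  shows "arrangement h permutes {1..n + 1}"
proof (rule bij_imp_permutes)
  have img: "arrangement h ` {1..n + 1} = {1..n + 1}"
  proof -
    have "{1..n + 1} = insert (n + 1) {1..n}" by auto
    moreover have "arrangement h ` {1..n} = palette h"
      unfolding palette_def by (intro image_cong) (auto simp: arrangement_def)
    moreover have "arrangement h (n + 1) = missing h" by (simp add: arrangement_def)
    ultimately show ?thesis using palette_missing(2)[OF assms] by (metis image_insert)
  qed
  then show "bij_betw (arrangement h) {1..n + 1} {1..n + 1}"
    by (simp add: bij_betw_def finite_surj_inj)
qed (auto simp: arrangement_def)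

lemma equal_arrangement:
  assumes V: "h \<in> V" "h' \<in> V" and r: "rainbow h" "rainbow h'"
    and same: "\<And>i. i \<in> {1..n} \<Longrightarrow> c (x i) h' = c (x i) h"
  shows "missing h' = missing h" "arrangement h' = arrangement h"
proof -
  show m: "missing h' = missing h"
    using missing_eqI[OF V(2) r(2) missing_range[OF V(1) r(1)]] same missing_neq[OF V(1) r(1)]
    by metis
  show "arrangement h' = arrangement h"
    using same m by (auto simp: arrangement_def)
qed

lemma swapped_arrangement:
  assumes V: "h \<in> V" "h' \<in> V" and r: "rainbow h" "rainbow h'" and k: "k \<in> {1..n}"
    and swap: "c (x k) h' = missing h"
    and same: "\<And>i. i \<in> {1..n} \<Longrightarrow> i \<noteq> k \<Longrightarrow> c (x i) h' = c (x i) h"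
  shows "missing h' = c (x k) h" "evenperm (arrangement h') \<noteq> evenperm (arrangement h)"
proof -
  have "c (x i) h' \<noteq> c (x k) h" if i: "i \<in> {1..n}" for i
  proof (cases "i = k")
    case True
    then show ?thesis using swap missing_neq[OF V(1) r(1) k] by metis
  next
    case False
    then show ?thesis
      using same[OF i] r(1) i k unfolding rainbow_def by (metis inj_on_eq_iff)
  qed
  then show m: "missing h' = c (x k) h"
    by (intro missing_eqI V r named_range k)
  have "arrangement h' = arrangement h \<circ> transpose k (n + 1)"
    using k same swap m by (auto simp: arrangement_def transpose_def fun_eq_iff)
  moreover have "permutation (arrangement h)"
    using arrangement_permutes[OF V(1) r(1)] permutes_imp_permutation by blast
  moreover have "k \<noteq> n + 1" using k by simp
  ultimately show "evenperm (arrangement h') \<noteq> evenperm (arrangement h)"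
    by (simp add: evenperm_comp permutation_swap_id evenperm_swap)
qed

text \<open>
  The vertex \<open>w\<close> forces the difference. Let \<open>m\<close> be the common missing colour. The colour of \<open>w\<close> at \<open>h\<close> is
  unavailable to all of \<open>x'\<close>, \<open>y'\<close>, \<open>z'\<close> at \<open>h'\<close>, and this removes one of the two options that each
  \<open>x' i\<close> and \<open>y' i\<close> has, for all \<open>i\<close> if that colour is \<open>m\<close> and for one \<open>i = a\<close> otherwise. The
  first case forces \<open>c z h = m\<close> and the second \<open>c z h \<noteq> m\<close>. In either case, the wrong colour of \<open>z\<close>
  at \<open>h'\<close> would determine the colours of the \<open>y i\<close> at \<open>h\<close> so far that these, together with the colour
  of \<open>w\<close>, leave none for \<open>z'\<close> at \<open>h'\<close>.
\<close>

lemma equal_palette_apex: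
  assumes e: "(h, h') \<in> B" and r: "rainbow h" "rainbow h'"
    and same: "\<And>i. i \<in> {1..n} \<Longrightarrow> c (x i) h' = c (x i) h"
  shows "apex_missing h' \<noteq> apex_missing h"
proof -
  define m where "m = missing h"
  note V = B_V[OF e]
  have m': "missing h' = m" using equal_arrangement(1)[OF V r same] m_def by simp
  have Y: "c (y i) h = c (x i) h \<or> c (y i) h = m" if "i \<in> {1..n}" for i
    using neighbour_color[OF r(2) B_sym[OF e] that xy] that same m' by metis
  have X': "c (x' i) h' = c (x i) h \<or> c (x' i) h' = m" if "i \<in> {1..n}" for i
    using neighbour_color[OF r(1) e that xx'] that m_def by metis
  have Y': "c (y' i) h' = c (x i) h \<or> c (y' i) h' = m" if "i \<in> {1..n}" for i
    using neighbour_color[OF r(1) e that xy'] that m_def by metis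
  have z: "c z h = m \<or> (\<exists>i\<in>{1..n}. c z h = c (x i) h)"
    using color_cases[OF V(1) r(1) named_range(3)[OF V(1)]] m_def by metis
  have z2: "c z h' = m \<or> (\<exists>i\<in>{1..n}. c z h' = c (x i) h)"
    using color_cases[OF V(2) r(2) named_range(3)[OF V(2)]] m' same by metis
  have z': "c z' h' = m \<or> (\<exists>i\<in>{1..n}. c z' h' = c (x i) h)"
    using color_cases[OF V(2) r(2) named_range(4)[OF V(2)]] m' same by metis
  have zy: "c (y i) h \<noteq> c z h'" if "i \<in> {1..n}" for i
    using c_proper[OF yz[OF that] e] .
  have zY': "c (y' i) h' \<noteq> c z h" if "i \<in> {1..n}" for i
    using c_proper[OF zy'[OF that] e] by simp
  have z'y: "c z' h' \<noteq> c (y i) h" if "i \<in> {1..n}" for i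
    using c_proper[OF yz'[OF that] e] by simp
  have w: "c (x' i) h' \<noteq> c w h" "c (y' i) h' \<noteq> c w h" if "i \<in> {1..n}" for i
    using c_proper[OF x'w[OF that] B_sym[OF e]] c_proper[OF y'w[OF that] B_sym[OF e]] by auto
  have wz': "c z' h' \<noteq> c w h" using c_proper[OF z'w B_sym[OF e]] .
  show ?thesis
  proof (cases rule: color_cases[OF V(1) r(1) named_range(5)[OF V(1)]])
    case 1
    then have wm: "c w h = m" by (simp add: m_def)
    have y': "c (y' i) h' = c (x i) h" if "i \<in> {1..n}" for i
      using Y'[OF that] w(2)[OF that] wm by simp
    then have zm: "c z h = m" using z zY' by metis
    have "c z h' \<noteq> m"
    proof
      assume "c z h' = m"
      then have "c (y i) h = c (x i) h" if "i \<in> {1..n}" for i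
        using Y[OF that] zy[OF that] by simp
      then have "c z' h' = m" using z' z'y by metis
      then show False using wz' wm by simp
    qed
    then show ?thesis using zm m' m_def by (simp add: apex_missing_def)
  next
    case (2 a)
    have ya: "c (y' a) h' = m" using Y'[OF 2(1)] w(2)[OF 2(1)] 2(2) by simp
    then have zm: "c z h \<noteq> m" using zY'[OF 2(1)] by simp
    have xa: "c (x' a) h' = m" using X'[OF 2(1)] w(1)[OF 2(1)] 2(2) by simp
    have y: "c (y j) h = c (x j) h" if "j \<in> {1..n}" "j \<noteq> a" for j
      using Y[OF that(1)] c_proper[OF yx'[OF that(1) 2(1) that(2)] e] xa by simp
    have "c z h' = m"
    proof (rule ccontr)
      assume "c z h' \<noteq> m"
      then obtain l where l: "l \<in> {1..n}" "c z h' = c (x l) h" using z2 by blast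
      then have yl: "c (y l) h = m" using Y zy by metis
      then have "l = a" using y l(1) missing_neq[OF V(1) r(1) l(1)] m_def by metis
      then have "c z' h' \<noteq> m" using z'y[OF l(1)] yl by simp
      then obtain i where i: "i \<in> {1..n}" "c z' h' = c (x i) h" using z' by blast
      then have "i \<noteq> a" using wz' 2(2) by metis
      then show False using y i z'y by metis
    qed
    then show ?thesis using zm m' m_def by (simp add: apex_missing_def)
  qed
qed

text \<open>
  As \<open>z\<close> is adjacent to every \<open>y i\<close>, having the missing colour at \<open>z\<close> on one side forbids it at the
  \<open>y i\<close> on the other side; and a palette colour, of \<open>x i\<close> say, at \<open>z\<close> leaves only the missing
  colour to \<open>y i\<close>.
\<close>

lemma locked_equal_palette:
  assumes e: "(h, h') \<in> B" and l: "locked h" "locked h'"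
    and same: "\<And>i. i \<in> {1..n} \<Longrightarrow> c (x i) h' = c (x i) h"
    and ap: "apex_missing h"
  shows "copy_missing h" "\<not> copy_missing h'"
proof -
  note V = B_V[OF e]
  note r = l[THEN locked_rainbow]
  have m: "missing h' = missing h" by (rule equal_arrangement(1)[OF V r same])
  show "\<not> copy_missing h'"
    using c_proper[OF yz B_sym[OF e]] ap m unfolding apex_missing_def copy_missing_def by metis
  have "c z h' \<noteq> missing h'"
    using equal_palette_apex[OF e r same] ap unfolding apex_missing_def by blast
  then obtain i where i: "i \<in> {1..n}" "c z h' = c (x i) h"
    using color_cases[OF V(2) r(2) named_range(3)[OF V(2)]] same by metis
  then have "c (y i) h = missing h"
    using locked_copy[OF l(1) i(1)] c_proper[OF yz[OF i(1)] e] by metis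
  then show "copy_missing h" using i(1) unfolding copy_missing_def by blast
qed

text \<open>
  Let \<open>p\<close> and \<open>q\<close> be the two exchanged colours, where \<open>p\<close> is missing at \<open>h\<close> and \<open>q\<close> at \<open>h'\<close>. At \<open>h'\<close>, the
  vertices \<open>y i\<close> with \<open>i \<noteq> k\<close> have the colours of the \<open>x i\<close>, so \<open>z\<close> at \<open>h\<close> is left with \<open>p\<close> and \<open>q\<close>, and
  takes the one that \<open>y k\<close> does not have at \<open>h'\<close>.
\<close>

lemma locked_swapped_palette:
  assumes e: "(h, h') \<in> B" and l: "locked h" "locked h'" and k: "k \<in> {1..n}"
    and swap: "c (x k) h' = missing h"
    and same: "\<And>i. i \<in> {1..n} \<Longrightarrow> i \<noteq> k \<Longrightarrow> c (x i) h' = c (x i) h"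
  shows "apex_missing h \<longleftrightarrow> copy_missing h'"
proof -
  note V = B_V[OF e]
  note r = l[THEN locked_rainbow]
  have m': "missing h' = c (x k) h" by (rule swapped_arrangement(1)[OF V r k swap same])
  have y': "c (y i) h' = c (x i) h" if "i \<in> {1..n}" "i \<noteq> k" for i
    using locked_copy[OF l(2) that(1)] same[OF that] m'
      c_proper[OF xy[OF k that(1)] e] that(2) by metis
  have yk: "c (y k) h' = missing h \<or> c (y k) h' = c (x k) h"
    using locked_copy[OF l(2) k] swap m' by simp
  have zy: "c (y i) h' \<noteq> c z h" if "i \<in> {1..n}" for i
    using c_proper[OF yz[OF that] B_sym[OF e]] .
  have z: "c z h = missing h \<or> c z h = c (x k) h"
    using color_cases[OF V(1) r(1) named_range(3)[OF V(1)]] zy y' by metis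
  have "copy_missing h' \<longleftrightarrow> c (y k) h' = c (x k) h"
  proof
    assume "copy_missing h'"
    then obtain i where i: "i \<in> {1..n}" "c (y i) h' = c (x k) h"
      unfolding copy_missing_def m' by blast
    then have "i = k" using y' r(1) k unfolding rainbow_def by (metis inj_on_eq_iff)
    then show "c (y k) h' = c (x k) h" using i by simp
  qed (use k m' in \<open>auto simp: copy_missing_def\<close>)
  then show ?thesis
    using yk zy[OF k] z missing_neq[OF V(1) r(1) k] unfolding apex_missing_def by metis
qed

lemma locked_sides:
  assumes e: "(h, h') \<in> B" and l: "locked h" "locked h'"
  shows "side h' \<noteq> side h"
proof -
  note V = B_V[OF e]
  note r = l[THEN locked_rainbow]
  have x: "c (x i) h' = c (x i) h \<or> c (x i) h' = missing h" if "i \<in> {1..n}" for i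
    using neighbour_color[OF r(1) e that xx] that by blast
  show ?thesis
  proof (cases "\<exists>k\<in>{1..n}. c (x k) h' = missing h")
    case True
    then obtain k where k: "k \<in> {1..n}" and swap: "c (x k) h' = missing h" by blast
    have same: "c (x i) h' = c (x i) h" if "i \<in> {1..n}" "i \<noteq> k" for i
      using x[OF that(1)] swap that k r(2) unfolding rainbow_def by (metis inj_on_eq_iff)
    note m = swapped_arrangement[OF V r k swap same]
    have "apex_missing h \<longleftrightarrow> copy_missing h'"
      by (rule locked_swapped_palette[OF e l k swap same])
    moreover have "apex_missing h' \<longleftrightarrow> copy_missing h"
      by (rule locked_swapped_palette[OF B_sym[OF e] l(2,1) k]) (use m same in simp_all)
    ultimately show ?thesis using m(2) unfolding side_def by auto
  next
    case False
    then have same: "c (x i) h' = c (x i) h" if "i \<in> {1..n}" for i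
      using x that by blast
    have "apex_missing h' \<noteq> apex_missing h" by (rule equal_palette_apex[OF e r same])
    moreover have "apex_missing h \<Longrightarrow> copy_missing h \<and> \<not> copy_missing h'"
      using locked_equal_palette[OF e l same] by blast
    moreover have "apex_missing h' \<Longrightarrow> copy_missing h' \<and> \<not> copy_missing h"
      using locked_equal_palette[OF B_sym[OF e] l(2,1)] same by simp
    moreover have "arrangement h' = arrangement h"
      by (rule equal_arrangement(2)[OF V r same])
    ultimately show ?thesis
      unfolding side_def by (cases "apex_missing h") simp_all
  qed
qed

subsection \<open>The colouring of the second factor\<close>

definition color :: "'b \<Rightarrow> nat" where
  "color h = (if \<exists>k. free h k then SOME k. free h k else if side h then c (x 1) h else c (x 2) h)"

lemma color_free: "\<not> locked h \<Longrightarrow> h \<in> V \<Longrightarrow> free h (color h)"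
  unfolding color_def locked_def by (auto intro: someI_ex)

lemma color_locked: "locked h \<Longrightarrow> color h = (if side h then c (x 1) h else c (x 2) h)"
  unfolding color_def locked_def by auto

lemma color_in_palette:
  assumes "h \<in> V"
  shows "color h \<in> palette h"
proof (cases "locked h")
  case True
  then show ?thesis using n_ge_2 by (auto simp: color_locked palette_def)
next
  case False
  then show ?thesis using color_free[OF False assms] unfolding free_def by blast
qed

lemma color_range:
  assumes "h \<in> V"
  shows "color h \<in> {1..n + 1}"
  using color_in_palette[OF assms] named_range(1)[OF assms] unfolding palette_def
  by (elim imageE) simp

lemma color_proper:
  assumes e: "(h, h') \<in> B"
  shows "color h \<noteq> color h'"
proof -
  note V = B_V[OF e]
  show ?thesis
  proof (cases "locked h \<and> locked h'")
    case True
    have "(x 1, x 2) \<in> A" by (rule xx) (use n_ge_2 in simp_all)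
    then have "c (x 1) h \<noteq> c (x 2) h'" "c (x 2) h \<noteq> c (x 1) h'"
      using c_proper[OF _ e] A_sym by simp_all
    then show ?thesis using locked_sides[OF e] True by (auto simp: color_locked)
  next
    case False
    then show ?thesis
      using color_free V color_in_palette e B_sym[OF e] unfolding free_def by metis
  qed
qed

end

section \<open>Arcs of the Mycielskian\<close>

definition wf_sym_graph :: "'a pair_pre_digraph \<Rightarrow> bool" where
  "wf_sym_graph G \<longleftrightarrow> parcs G \<subseteq> pverts G \<times> pverts G \<and> sym (parcs G)"

text \<open>The vertices of the Mycielskian are equivalence classes: singletons below the apex.\<close>

definition level :: "nat \<Rightarrow> 'a \<Rightarrow> ('a \<times> nat) set" where
  "level i v = {(v, i)}"

definition apex :: "'a pair_pre_digraph \<Rightarrow> ('a \<times> nat) set" where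
  "apex G = pverts G \<times> {2}"

lemma level_vertex:
  assumes "v \<in> pverts G" "i \<in> {0, 1}"
  shows "level i v \<in> pverts (mycielskian G)"
proof -
  have "apex_rel (pverts G) `` {(v, i)} = level i v"
    using assms by (auto simp: apex_rel_def level_def)
  then show ?thesis
    using assms quotientI[of "(v, i)" "pverts G \<times> {0, 1, 2}" "apex_rel (pverts G)"]
    by (auto simp: mycielskian_def quotient_graph_def cat_product_def L2_def)
qed

lemma apex_vertex:
  assumes "v \<in> pverts G"
  shows "apex G \<in> pverts (mycielskian G)"
proof -
  have "apex_rel (pverts G) `` {(v, 2)} = apex G"
    using assms by (auto simp: apex_rel_def apex_def)
  then show ?thesis
    using assms quotientI[of "(v, 2)" "pverts G \<times> {0, 1, 2}" "apex_rel (pverts G)"]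
    by (simp add: mycielskian_def quotient_graph_def cat_product_def L2_def)
qed

lemma mycielskian_arcI:
  assumes "X \<in> pverts (mycielskian G)" "Y \<in> pverts (mycielskian G)"
    and "(u, i) \<in> X" "(v, j) \<in> Y" "(u, v) \<in> parcs G" "(i, j) \<in> parcs L2"
  shows "(X, Y) \<in> parcs (mycielskian G)"
proof -
  have "((u, i), (v, j)) \<in> parcs (cat_product G L2)"
    using assms(5,6) by (simp add: cat_product_def)
  with assms(1-4) show ?thesis
    unfolding mycielskian_def quotient_graph_def by fastforce
qed

lemma mycielskian_arcs:
  assumes G: "wf_sym_graph G" and e: "(u, v) \<in> parcs G"
  shows "(level 0 u, level 0 v) \<in> parcs (mycielskian G)"
    and "(level 0 u, level 1 v) \<in> parcs (mycielskian G)"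
    and "(level 1 u, apex G) \<in> parcs (mycielskian G)"
proof -
  have V: "u \<in> pverts G" "v \<in> pverts G" using G e by (auto simp: wf_sym_graph_def)
  show "(level 0 u, level 0 v) \<in> parcs (mycielskian G)"
    by (rule mycielskian_arcI[OF _ _ _ _ e, of _ _ 0 0])
      (use V in \<open>simp_all add: level_vertex, simp_all add: level_def L2_def\<close>)
  show "(level 0 u, level 1 v) \<in> parcs (mycielskian G)"
    by (rule mycielskian_arcI[OF _ _ _ _ e, of _ _ 0 1])
      (use V in \<open>simp_all add: level_vertex, simp_all add: level_def L2_def\<close>)
  show "(level 1 u, apex G) \<in> parcs (mycielskian G)"
    by (rule mycielskian_arcI[OF _ _ _ _ e, of _ _ 1 2])
      (use V in \<open>simp_all add: level_vertex apex_vertex, simp_all add: level_def apex_def L2_def\<close>)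
qed

lemma mycielskian_wf_sym:
  assumes "wf_sym_graph G"
  shows "wf_sym_graph (mycielskian G)"
proof -
  have "sym (parcs L2)" by (auto simp: L2_def sym_def)
  then have "sym (parcs (cat_product G L2))"
    using assms by (auto simp: wf_sym_graph_def cat_product_def sym_def)
  then show ?thesis
    unfolding wf_sym_graph_def mycielskian_def quotient_graph_def sym_def by fastforce
qed

section \<open>Chromatic numbers of products\<close>

lemma contains_as_subgraph_hom:
  assumes "contains_as_subgraph G F"
  obtains f where "graph_hom F G f"
proof -
  obtain S where S: "subgraph (with_proj S) (with_proj G)"
      and "digraph_iso (with_proj F) (with_proj S)"
    using assms unfolding contains_as_subgraph_def by blast
  then obtain f where f: "pre_digraph.digraph_isomorphism (with_proj F) f"
      and Sf: "with_proj S = app_iso f (with_proj F)"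
    unfolding digraph_iso_def by blast
  have sub: "pverts S \<subseteq> pverts G" "parcs S \<subseteq> parcs G"
    using S by (simp_all add: subgraph_def)
  have v: "pverts S = iso_verts f ` pverts F" and a: "parcs S = iso_arcs f ` parcs F"
    and t: "fst = iso_tail f" and h: "snd = iso_head f"
    using arg_cong[OF Sf, of verts] arg_cong[OF Sf, of arcs]
      arg_cong[OF Sf, of tail] arg_cong[OF Sf, of head] by simp_all
  have "(iso_verts f p, iso_verts f q) \<in> parcs G" if "(p, q) \<in> parcs F" for p q
  proof -
    have "iso_verts f p = fst (iso_arcs f (p, q))" "iso_verts f q = snd (iso_arcs f (p, q))"
      using pre_digraph.iso_verts_tail[OF f, of "(p, q)"]
        pre_digraph.iso_verts_head[OF f, of "(p, q)"] that t h by simp_all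
    then have "(iso_verts f p, iso_verts f q) = iso_arcs f (p, q)" by simp
    then show ?thesis using that a sub(2) by auto
  qed
  then have "graph_hom F G (iso_verts f)"
    using v sub(1) by (auto simp: graph_hom_def)
  then show ?thesis using that by blast
qed

text \<open>
  The inner \<open>level\<close> refers to the first Mycielskian and the outer one to the second, which gives
  the dictionary for \<open>x\<close>, \<open>y\<close>, \<open>x'\<close>, \<open>y'\<close>, \<open>z\<close>, \<open>z'\<close> and \<open>w\<close>.
\<close>

lemma colorable_if_product_colorable:
  assumes n: "n \<ge> 2" and G: "sym (parcs G)" "parcs G \<subseteq> pverts G \<times> pverts G"
    and H: "sym (parcs H)" "parcs H \<subseteq> pverts H \<times> pverts H"
    and f: "graph_hom (mycielskian (mycielskian (complete_graph n))) G f"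
    and \<phi>: "graph_hom (cat_product G H) (complete_graph (n + 1)) \<phi>"
  shows "\<exists>\<psi>. graph_hom H (complete_graph (n + 1)) \<psi>"
proof -
  let ?K = "complete_graph n" let ?M = "mycielskian ?K"
  have wK: "wf_sym_graph ?K"
    by (auto simp: wf_sym_graph_def complete_graph_def sym_def)
  note wM = mycielskian_wf_sym[OF wK]
  have K: "(i, j) \<in> parcs ?K" if "i \<in> {1..n}" "j \<in> {1..n}" "i \<noteq> j" for i j
    using that by (simp add: complete_graph_def)
  have Kex: "\<exists>j. (i, j) \<in> parcs ?K" if "i \<in> {1..n}" for i
  proof (cases "i = 1")
    case True
    then show ?thesis using K[of i 2] n by auto
  next
    case False
    then show ?thesis using K[of i 1] that n by auto
  qed
  note MK = mycielskian_arcs[OF wK]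
  note MM = mycielskian_arcs[OF wM]
  have symM: "(q, p) \<in> parcs ?M" if "(p, q) \<in> parcs ?M" for p q
    using wM that by (auto simp: wf_sym_graph_def dest: symD)
  have A: "(p, q) \<in> parcs (mycielskian ?M) \<Longrightarrow> (f p, f q) \<in> parcs G" for p q
    using f by (simp add: graph_hom_def)
  \<comment> \<open>The arc from \<open>z'\<close> to \<open>w\<close> exists only because the first apex is not isolated.\<close>
  have "1 \<in> {1..n}" using n by simp
  then have apex1: "\<exists>q. (apex ?K, q) \<in> parcs ?M"
    using Kex MK(3) symM by metis
  interpret double_mycielskian_coloring n "parcs G" "parcs H" "pverts H"
    "\<lambda>i. f (level 0 (level 0 i))" "\<lambda>i. f (level 0 (level 1 i))"
    "\<lambda>i. f (level 1 (level 0 i))" "\<lambda>i. f (level 1 (level 1 i))"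
    "f (level 0 (apex ?K))" "f (level 1 (apex ?K))" "f (apex ?M)"
    "\<lambda>g h. \<phi> (g, h)"
  proof unfold_locales
    fix u v h assume "(u, v) \<in> parcs G" "h \<in> pverts H"
    then show "\<phi> (u, h) \<in> {1..n + 1}"
      using \<phi> G(2) by (auto simp: graph_hom_def cat_product_def complete_graph_def)
  next
    fix u v h h' assume "(u, v) \<in> parcs G" "(h, h') \<in> parcs H"
    then have "(\<phi> (u, h), \<phi> (v, h')) \<in> parcs (complete_graph (n + 1))"
      using \<phi> unfolding graph_hom_def cat_product_def by simp
    then show "\<phi> (u, h) \<noteq> \<phi> (v, h')" by (simp add: complete_graph_def)
  next
    fix i assume "i \<in> {1..n}"
    then show "(f (level 0 (level 1 i)), f (level 0 (apex ?K))) \<in> parcs G"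
      and "(f (level 0 (level 1 i)), f (level 1 (apex ?K))) \<in> parcs G"
      and "(f (level 0 (apex ?K)), f (level 1 (level 1 i))) \<in> parcs G"
      and "(f (level 1 (level 0 i)), f (apex ?M)) \<in> parcs G"
      and "(f (level 1 (level 1 i)), f (apex ?M)) \<in> parcs G"
      using A MM MK(1,3) Kex symM by metis+
  next
    show "(f (level 1 (apex ?K)), f (apex ?M)) \<in> parcs G"
      using A MM(3) apex1 by metis
  qed (use n G H A MM MK K symM in metis)+
  have "graph_hom H (complete_graph (n + 1)) color"
    using color_range color_proper B_V by (auto simp: graph_hom_def complete_graph_def)
  then show ?thesis by blast
qed

lemma chromatic_number_le: "graph_hom G (complete_graph n) f \<Longrightarrow> chromatic_number G \<le> n"
  unfolding chromatic_number_def by (rule Least_le) blast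

text \<open>A least number of colours says something only if some number of colours suffices.\<close>

lemma chromatic_number_attained:
  assumes "graph_hom G (complete_graph n) f"
  shows "\<exists>g. graph_hom G (complete_graph (chromatic_number G)) g"
  unfolding chromatic_number_def
  by (rule LeastI_ex[of "\<lambda>n. \<exists>f. graph_hom G (complete_graph n) f"]) (use assms in blast)

lemma (in pair_graph) finite_chromatic_number_attained:
  "\<exists>f. graph_hom G (complete_graph (chromatic_number G)) f"
proof -
  obtain f where "bij_betw f (pverts G) {1..card (pverts G)}"
    using finite_same_card_bij[OF pair_finite_verts, of "{1..card (pverts G)}"] by auto
  then have f: "f v \<in> {1..card (pverts G)}" and inj: "f u = f v \<Longrightarrow> u = v"
    if "u \<in> pverts G" "v \<in> pverts G" for u v
    using that by (auto simp: bij_betw_def dest: inj_onD)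
  have "u \<in> pverts G" "v \<in> pverts G" "u \<noteq> v" if "(u, v) \<in> parcs G" for u v
    using arc_fst_in_verts[OF that] arc_snd_in_verts[OF that] pair_no_loops[OF that] by simp_all
  then have "graph_hom G (complete_graph (card (pverts G))) f"
    unfolding graph_hom_def complete_graph_def using f inj by simp blast
  then show ?thesis by (rule chromatic_number_attained)
qed

lemma product_colorings:
  shows "graph_hom G K f \<Longrightarrow> graph_hom (cat_product G H) K (f \<circ> fst)"
    and "graph_hom H K g \<Longrightarrow> graph_hom (cat_product G H) K (g \<circ> snd)"
  by (auto simp: graph_hom_def cat_product_def)

theorem theorem1p12:
  fixes n :: nat
    and G :: "'a pair_pre_digraph"
    and H :: "'b pair_pre_digraph"
  assumes "n \<ge> 2"
    and "pair_graph G"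
    and "contains_as_subgraph G (mycielskian (mycielskian (complete_graph n)))"
    and "pair_graph H"
    and "chromatic_number (cat_product G H) = n + 1"
  shows "min (chromatic_number G) (chromatic_number H) = n + 1"
proof -
  interpret G: pair_graph G by fact
  interpret H: pair_graph H by fact
  obtain g where "graph_hom G (complete_graph (chromatic_number G)) g"
    using G.finite_chromatic_number_attained by blast
  note g = product_colorings(1)[OF this, of H]
  obtain h where "graph_hom H (complete_graph (chromatic_number H)) h"
    using H.finite_chromatic_number_attained by blast
  note h = product_colorings(2)[OF this, of G]
  have lower: "n + 1 \<le> chromatic_number G" "n + 1 \<le> chromatic_number H"
    using chromatic_number_le[OF g] chromatic_number_le[OF h] assms(5) by simp_all
  obtain \<phi> where \<phi>: "graph_hom (cat_product G H) (complete_graph (n + 1)) \<phi>"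
    using chromatic_number_attained[OF g] assms(5) by auto
  obtain f where f: "graph_hom (mycielskian (mycielskian (complete_graph n))) G f"
    using contains_as_subgraph_hom[OF assms(3)] .
  have "sym (parcs G)" "sym (parcs H)"
    using G.pair_sym_arcs H.pair_sym_arcs by (simp_all add: symmetric_def)
  then obtain \<psi> where "graph_hom H (complete_graph (n + 1)) \<psi>"
    using colorable_if_product_colorable[OF assms(1) _ _ _ _ f \<phi>]
      G.arc_fst_in_verts G.arc_snd_in_verts H.arc_fst_in_verts H.arc_snd_in_verts
    by (metis mem_Times_iff subsetI)
  then have "chromatic_number H \<le> n + 1" by (rule chromatic_number_le)
  with lower show ?thesis by simp
qed

end
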